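(* Suppose the global state is TPS-invariant at $t_0$ and $t_1>t_0$, i.e. $\rho_{\bar i}(t_a)\in\mathcal A_{\bar i}^{X^a}$, $a=0,1$, for some bilocal unitaries $X^a=Y_j^a\otimes Z_S^a$. Then, between these times: (1) the changes in the entropy of the "other frame" and $S$ subsystems are the same in both perspectives, i.e. $$\Delta S_i=\Delta S_j,\qquad \Delta S_{S|R_j}=\Delta S_{S|R_i}.$$ When $\rho_{\bar i}(t_0)$ is pure, one has the additional equality $\Delta S_j=\Delta S_{S|R_i}$, and so all entropy changes are equal. (2) the entropy production in the subsystem $S$ and the entropy flow out of $S$ are equal in both perspectives, i.e. $$\Sigma_{\bar j}=\Sigma_{\bar i},\qquad \Phi_{\bar j}=\Phi_{\bar i},$$ if and only if the initial state is of product form and $$S\bigl[\hat Y_j^{01}(\rho_j(t_1))\,\|\,\rho_j(t_0)\bigr]=S\bigl[\rho_j(t_1)\,\|\,\rho_j(t_0)\bigr],\qquad Y_j^{01}=Y_j^0Y_j^{1\dagger}.$$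
   Context: $\mathcal G$ is a finite abelian group, $\mathcal G\neq\{e\}$. For $i=1,2$ (two ideal quantum reference frames $R_1,R_2$), $\mathcal H_i=\ell^2(\mathcal G)$ has orthonormal basis $\{|g\rangle_i\}_{g\in\mathcal G}$. $\mathcal H_S$ is a finite-dimensional complex Hilbert space carrying a unitary representation $g\mapsto U_S^g$. For $i\neq j$, $\mathcal H_{\bar i}=\mathcal H_j\otimes\mathcal H_S$, $\mathcal A_{\bar i}=\mathcal L(\mathcal H_{\bar i})$. For a unitary $W$: $\hat W(A)=WAW^\dagger$, $\hat W^\dagger(A)=W^\dagger AW$. Fix orientations $g_i,g_j\in\mathcal G$. Frame change: $V_{i\to j}^{g_i,g_j}=\sum_g|gg_i\rangle_i\otimes\langle g_jg^{-1}|_j\otimes U_S^g:\mathcal H_{\bar i}\to\mathcal H_{\bar j}$. Let $\mathbf U_{\bar i}^{g_i,g_j}=\sum_g|g_ig\rangle\langle g_jg^{-1}|_j\otimes U_S^g$. For a bilocal unitary $X=Y_j\otimes Z_S$, $\mathcal A_{\bar i}^X=\{f\in\mathcal A_{\bar i}:\hat{\mathbf U}_{\bar i}^{g_i,g_j}(f)=\hat X^\dagger(f)\}$. The global state $\rho_{\bar i}(t)$ evolves unitarily under a time-independent Hamiltonian on $\mathcal H_{\bar i}$, and $\rho_{\bar j}(t)=\hat V_{i\to j}^{g_i,g_j}(\rho_{\bar i}(t))$. Reduced states: $\rho_j=\mathrm{Tr}_S\rho_{\bar i}$, $\rho_{S|R_i}=\mathrm{Tr}_j\rho_{\bar i}$,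 $\rho_i=\mathrm{Tr}_S\rho_{\bar j}$, $\rho_{S|R_j}=\mathrm{Tr}_i\rho_{\bar j}$. Let $S_{\rm vN}[\rho]=-\mathrm{Tr}(\rho\log\rho)$, $S[\rho\|\sigma]=\mathrm{Tr}(\rho\log\rho-\rho\log\sigma)$ (possibly $+\infty$), $I[\rho_{\bar i}]=S[\rho_{\bar i}\|\rho_j\otimes\rho_{S|R_i}]$. Entropy changes between $t_0$ and $t_1$: $\Delta S_j=S_{\rm vN}[\rho_j(t_1)]-S_{\rm vN}[\rho_j(t_0)]$, and similarly $\Delta S_i,\Delta S_{S|R_i},\Delta S_{S|R_j}$. Entropy production and flow in $R_i$-perspective are defined for initial states of product form $\rho_{\bar i}(t_0)=\rho_j(t_0)\otimes\rho_{S|R_i}(t_0)$ by $$\Sigma_{\bar i}=I[\rho_{\bar i}(t_1)]+S[\rho_j(t_1)\|\rho_j(t_0)],\qquad \Phi_{\bar i}=\Delta S_j+S[\rho_j(t_1)\|\rho_j(t_0)],$$ and analogously in $R_j$-perspective with $i$ and $j$ exchanged (product form of the initial state being part of what it means for these quantities to be defined). *)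

theory Defs
  imports "HOL-Analysis.Analysis"
begin

(* Finite-dimensional Hilbert spaces are complex^'n with the standard inner product, and
   operators are matrices in the standard basis. Each frame space l^2(G) is complex^'g, where
   the index type 'g is itself the finite abelian group, written additively: "g + h" stands for
   gh and "- g" for the inverse of g. The system space is complex^'s. A tensor product
   "frame (x) system" is complex^('g \<times> 's), the frame always being the first factor. *)


text \<open>Matrices\<close>

type_synonym 'n cmat = "complex^'n^'n"

definition dagger :: "complex^'m^'n \<Rightarrow> complex^'n^'m"
  where "dagger A = map_matrix cnj (transpose A)"

definition cinner :: "complex^'n \<Rightarrow> complex^'n \<Rightarrow> complex"
  where "cinner v w = (\<Sum>i\<in>UNIV. cnj (v $ i) * w $ i)"

definition hermitian :: "'n::finite cmat \<Rightarrow> bool"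
  where "hermitian A \<longleftrightarrow> dagger A = A"

definition unitary :: "'n::finite cmat \<Rightarrow> bool"
  where "unitary W \<longleftrightarrow> W ** dagger W = mat 1 \<and> dagger W ** W = mat 1"

text \<open>\<open>conj_by W\<close> is the superoperator \<open>A \<mapsto> W A W\<dagger>\<close>; accordingly
  \<open>conj_by (dagger W)\<close> is \<open>A \<mapsto> W\<dagger> A W\<close>.\<close>

definition conj_by :: "complex^'m^'n \<Rightarrow> complex^'m^'m \<Rightarrow> complex^'n^'n"
  where "conj_by W A = W ** A ** dagger W"

definition outer :: "complex^'n \<Rightarrow> complex^'m \<Rightarrow> complex^'m^'n"
  where "outer v w = (\<chi> a b. v $ a * cnj (w $ b))"

definition ket_bra :: "'n \<Rightarrow> 'm \<Rightarrow> complex^'m^'n"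
  where "ket_bra a b = outer (axis a 1) (axis b 1)"

definition kron :: "complex^'m^'n \<Rightarrow> complex^'k^'l \<Rightarrow> complex^('m \<times> 'k)^('n \<times> 'l)"
  where "kron A B = (\<chi> p q. A $ fst p $ fst q * B $ snd p $ snd q)"

definition ptrace_sys :: "('f::finite \<times> 's::finite) cmat \<Rightarrow> 'f cmat"
  where "ptrace_sys A = (\<chi> a b. \<Sum>s\<in>UNIV. A $ (a, s) $ (b, s))"

definition ptrace_frame :: "('f::finite \<times> 's::finite) cmat \<Rightarrow> 's cmat"
  where "ptrace_frame A = (\<chi> s t. \<Sum>a\<in>UNIV. A $ (a, s) $ (a, t))"


text \<open>Functional calculus \<open>f(A) = \<Sum>\<^sub>\<lambda> f(\<lambda>) P\<^sub>\<lambda>\<close> of a Hermitian matrix \<open>A\<close>, where \<open>\<lambda>\<close> ranges over the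
  (real) spectrum and \<open>P\<^sub>\<lambda>\<close> is the orthogonal projection onto the \<open>\<lambda>\<close>-eigenspace\<close>

definition eigenspace :: "complex^'n^'n \<Rightarrow> real \<Rightarrow> (complex^'n) set"
  where "eigenspace A r = {v. A *v v = of_real r *s v}"

definition spectrum :: "'n::finite cmat \<Rightarrow> real set"
  where "spectrum A = {r. \<exists>v. v \<noteq> 0 \<and> A *v v = of_real r *s v}"

definition orth_proj :: "(complex^'n) set \<Rightarrow> complex^'n^'n"
  where "orth_proj E = (THE P. hermitian P \<and> P ** P = P \<and> range ((*v) P) = E)"

definition matrix_fun :: "(real \<Rightarrow> complex) \<Rightarrow> 'n::finite cmat \<Rightarrow> 'n cmat"
  where "matrix_fun f A = (\<Sum>r\<in>spectrum A. mat (f r) ** orth_proj (eigenspace A r))"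

text \<open>Here \<open>ln 0 = 0\<close>, i.e. the logarithm is set to zero on the kernel. The value chosen there does
  not influence the entropies below: it is always multiplied by a state vanishing on that kernel.\<close>

definition matrix_log :: "'n::finite cmat \<Rightarrow> 'n cmat"
  where "matrix_log A = matrix_fun (\<lambda>r. of_real (ln r)) A"


text \<open>States and dynamics\<close>

definition density_op :: "'n::finite cmat \<Rightarrow> bool"
  where "density_op \<rho> \<longleftrightarrow>
    hermitian \<rho> \<and> (\<forall>v. 0 \<le> Re (cinner v (\<rho> *v v))) \<and> trace \<rho> = 1"

definition pure_state :: "'n::finite cmat \<Rightarrow> bool"
  where "pure_state \<rho> \<longleftrightarrow> (\<exists>\<psi>. cinner \<psi> \<psi> = 1 \<and> \<rho> = outer \<psi> \<psi>)"

definition product_form :: "('f::finite \<times> 's::finite) cmat \<Rightarrow> bool"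
  where "product_form \<rho> \<longleftrightarrow> \<rho> = kron (ptrace_sys \<rho>) (ptrace_frame \<rho>)"

text \<open>\<open>exp (- i t H)\<close>, in units with \<open>\<hbar> = 1\<close>\<close>

definition propagator :: "'n::finite cmat \<Rightarrow> real \<Rightarrow> 'n cmat"
  where "propagator H t = matrix_fun (\<lambda>r. exp (- (\<i> * of_real t * of_real r))) H"

definition evolves_under :: "'n::finite cmat \<Rightarrow> (real \<Rightarrow> 'n cmat) \<Rightarrow> bool"
  where "evolves_under H \<rho> \<longleftrightarrow> (\<forall>s t. \<rho> t = conj_by (propagator H (t - s)) (\<rho> s))"


text \<open>Entropies. The support of a Hermitian matrix (the orthogonal complement of its kernel) is
  its range.\<close>

definition vn_entropy :: "'n::finite cmat \<Rightarrow> real"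
  where "vn_entropy \<rho> = - Re (trace (\<rho> ** matrix_log \<rho>))"

definition relative_entropy :: "'n::finite cmat \<Rightarrow> 'n cmat \<Rightarrow> ereal"
  where "relative_entropy \<rho> \<sigma> =
    (if range ((*v) \<rho>) \<subseteq> range ((*v) \<sigma>)
     then ereal (Re (trace (\<rho> ** matrix_log \<rho> - \<rho> ** matrix_log \<sigma>)))
     else \<infinity>)"

definition mutual_information :: "('f::finite \<times> 's::finite) cmat \<Rightarrow> ereal"
  where "mutual_information \<rho> =
    relative_entropy \<rho> (kron (ptrace_sys \<rho>) (ptrace_frame \<rho>))"

definition entropy_change :: "(real \<Rightarrow> 'n::finite cmat) \<Rightarrow> real \<Rightarrow> real \<Rightarrow> real"
  where "entropy_change \<rho> t0 t1 = vn_entropy (\<rho> t1) - vn_entropy (\<rho> t0)"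

text \<open>Entropy production and flow are defined for trajectories with \<open>product_form (\<rho> t0)\<close> only. The
  functions below do not check this, so it has to be required wherever they are used.\<close>

definition entropy_production ::
  "(real \<Rightarrow> ('f::finite \<times> 's::finite) cmat) \<Rightarrow> real \<Rightarrow> real \<Rightarrow> ereal"
  where "entropy_production \<rho> t0 t1 =
    mutual_information (\<rho> t1) + relative_entropy (ptrace_sys (\<rho> t1)) (ptrace_sys (\<rho> t0))"

definition entropy_flow ::
  "(real \<Rightarrow> ('f::finite \<times> 's::finite) cmat) \<Rightarrow> real \<Rightarrow> real \<Rightarrow> ereal"
  where "entropy_flow \<rho> t0 t1 =
    ereal (entropy_change (\<lambda>t. ptrace_sys (\<rho> t)) t0 t1)
      + relative_entropy (ptrace_sys (\<rho> t1)) (ptrace_sys (\<rho> t0))"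


text \<open>Quantum reference frames\<close>

definition unitary_rep :: "('g::group_add \<Rightarrow> 's::finite cmat) \<Rightarrow> bool"
  where "unitary_rep U \<longleftrightarrow>
    (\<forall>g. unitary (U g)) \<and> U 0 = mat 1 \<and> (\<forall>g h. U (g + h) = U g ** U h)"

text \<open>\<open>frame_change gi gj U\<close> maps the perspective of \<open>R\<^sub>i\<close> (first factor: frame \<open>j\<close>) to that of \<open>R\<^sub>j\<close>
  (first factor: frame \<open>i\<close>), whereas \<open>parity_swap gi gj U\<close> acts within the perspective of \<open>R\<^sub>i\<close>.
  Since both frame spaces are \<open>complex^'g\<close>, the two have the same entries.\<close>

definition frame_change ::
  "'g::{finite,ab_group_add} \<Rightarrow> 'g \<Rightarrow> ('g \<Rightarrow> 's::finite cmat) \<Rightarrow> ('g \<times> 's) cmat"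
  where "frame_change gi gj U = (\<Sum>g\<in>UNIV. kron (ket_bra (g + gi) (gj - g)) (U g))"

definition parity_swap ::
  "'g::{finite,ab_group_add} \<Rightarrow> 'g \<Rightarrow> ('g \<Rightarrow> 's::finite cmat) \<Rightarrow> ('g \<times> 's) cmat"
  where "parity_swap gi gj U = (\<Sum>g\<in>UNIV. kron (ket_bra (gi + g) (gj - g)) (U g))"

definition tps_invariant ::
  "'g::{finite,ab_group_add} \<Rightarrow> 'g \<Rightarrow> ('g \<Rightarrow> 's::finite cmat) \<Rightarrow> ('g \<times> 's) cmat
    \<Rightarrow> (('g \<times> 's) cmat) set"
  where "tps_invariant gi gj U X =
    {f. conj_by (parity_swap gi gj U) f = conj_by (dagger X) f}"

end

theory Submission
  imports Defs
begin

text \<open>Frame change and parity swap have the same entries, so TPS invariance at \<open>t\<^sub>a\<close> says precisely that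
  the two perspectives are related by the bilocal unitary \<open>X\<^sup>a\<dagger>\<close>. Partial traces are covariant under
  bilocal unitaries and the functional calculus under all unitaries, which gives (1), and turns (2)
  into the cancellation of the (finite) entropy changes and of the mutual informations. For a pure
  state with coefficient matrix \<open>M\<close>, the reduced states are \<open>M M\<dagger>\<close> and the complex conjugate of
  \<open>M\<dagger> M\<close>, which have the same nonzero spectrum with multiplicities.\<close>

section \<open>Daggers, unitaries and tensor products\<close>

lemma dagger_nth [simp]: "dagger A $ i $ j = cnj (A $ j $ i)"
  by (simp add: dagger_def transpose_def map_matrix_def)

lemma dagger_dagger [simp]: "dagger (dagger A) = A"
  by (simp add: vec_eq_iff)

lemma dagger_mult: "dagger (A ** B) = dagger B ** dagger A"
  by (simp add: vec_eq_iff matrix_matrix_mult_def mult.commute)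

lemma dagger_scalar_mult: "dagger (mat c ** A) = mat (cnj c) ** dagger (A :: complex^'n^'m)"
  by (simp add: vec_eq_iff matrix_matrix_mult_def mat_def if_distrib[of "\<lambda>x. x * _"]
      cong: if_cong)

lemma scalar_matrix_commute: "A ** mat c = mat c ** (A :: 'a::comm_semiring_1^'n^'m)"
  by (simp add: vec_eq_iff matrix_matrix_mult_def mat_def if_distrib[of "\<lambda>x. x * _"]
      if_distrib[of "\<lambda>x. _ * x"] mult.commute cong: if_cong)

lemma scalar_matrix_vector: "mat c *v v = c *s (v :: 'a::comm_semiring_1^'n)"
  by (simp add: vec_eq_iff matrix_vector_mult_def mat_def if_distrib[of "\<lambda>x. x * _"] cong: if_cong)

lemma trace_scalar_mult: "trace (mat c ** A) = c * trace (A :: 'a::comm_semiring_1^'n^'n)"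
  by (simp add: trace_def matrix_matrix_mult_def mat_def if_distrib[of "\<lambda>x. x * _"]
      sum_distrib_left cong: if_cong)

lemma matrix_mult_sum_right: "A ** (\<Sum>i\<in>I. B i) = (\<Sum>i\<in>I. A ** (B i :: 'a::comm_ring_1^'n^'m))"
  by (simp add: vec_eq_iff matrix_matrix_mult_def sum_distrib_left sum.swap[of _ I])

lemma matrix_mult_sum_left: "(\<Sum>i\<in>I. B i) ** A = (\<Sum>i\<in>I. (B i :: 'a::comm_ring_1^'n^'m) ** A)"
  by (simp add: vec_eq_iff matrix_matrix_mult_def sum_distrib_right sum.swap[of _ I])

lemma trace_sum: "trace (\<Sum>i\<in>I. B i) = (\<Sum>i\<in>I. trace (B i :: 'a::comm_ring_1^'n^'n))"
  unfolding trace_def by (simp add: sum.swap[of _ I])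

lemma unitary_dagger: "unitary (dagger W) \<longleftrightarrow> unitary W"
  by (auto simp: unitary_def)

lemma conj_by_mult: "conj_by (V ** W) A = conj_by V (conj_by W A)"
  by (simp add: conj_by_def dagger_mult matrix_mul_assoc)

lemma conj_by_one [simp]: "conj_by (mat 1) A = A"
proof -
  have "dagger (mat 1 :: 'a cmat) = mat 1"
    by (auto simp: vec_eq_iff mat_def)
  then show ?thesis by (simp add: conj_by_def)
qed

lemma conj_by_dagger_cancel [simp]: "unitary W \<Longrightarrow> conj_by W (conj_by (dagger W) A) = A"
  by (simp add: unitary_def flip: conj_by_mult)

lemma conj_by_matrix_mult:
  assumes "unitary W"
  shows "conj_by W A ** conj_by W B = conj_by W (A ** B)"
proof -
  have "conj_by W A ** conj_by W B = W ** A ** (dagger W ** W) ** B ** dagger W"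
    by (simp add: conj_by_def matrix_mul_assoc)
  then show ?thesis
    using assms unfolding unitary_def by (simp add: conj_by_def matrix_mul_assoc[of W A B])
qed

lemma conj_by_diff: "conj_by W (A - B) = conj_by W A - conj_by W B"
  by (simp add: conj_by_def matrix_matrix_mult_def vec_eq_iff algebra_simps sum_subtractf)

lemma conj_by_sum: "conj_by W (\<Sum>i\<in>I. B i) = (\<Sum>i\<in>I. conj_by W (B i))"
  by (simp add: conj_by_def matrix_mult_sum_left matrix_mult_sum_right)

lemma conj_by_scalar_mult: "conj_by W (mat c ** A) = mat c ** conj_by W A"
  by (simp add: conj_by_def matrix_mul_assoc scalar_matrix_commute)

lemma trace_conj_by:
  assumes "unitary W"
  shows "trace (conj_by W A) = trace A"
proof -
  have "trace (conj_by W A) = trace (dagger W ** (W ** A))"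
    unfolding conj_by_def by (rule trace_mul_sym)
  then show ?thesis
    using assms by (simp add: unitary_def matrix_mul_assoc)
qed

lemma hermitian_conj_by: "hermitian A \<Longrightarrow> hermitian (conj_by W A)"
  by (simp add: hermitian_def conj_by_def dagger_mult matrix_mul_assoc)

lemma kron_mult: "kron A B ** kron C D = kron (A ** C) (B ** D)"
  by (simp add: vec_eq_iff kron_def matrix_matrix_mult_def sum_product sum.cartesian_product
      case_prod_beta mult_ac flip: UNIV_Times_UNIV)

lemma dagger_kron: "dagger (kron A B) = kron (dagger A) (dagger B)"
  by (simp add: vec_eq_iff kron_def)

lemma conj_by_kron: "conj_by (kron Y Z) (kron A B) = kron (conj_by Y A) (conj_by Z B)"
  by (simp add: conj_by_def dagger_kron kron_mult)

lemma unitary_kron: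
  assumes "unitary Y" "unitary Z"
  shows "unitary (kron Y Z)"
proof -
  have "kron (mat 1) (mat 1) = (mat 1 :: ('a \<times> 'b) cmat)"
    by (auto simp: vec_eq_iff kron_def mat_def)
  then show ?thesis
    using assms by (simp add: unitary_def dagger_kron kron_mult)
qed

section \<open>Partial traces under bilocal unitaries\<close>

lemma sum_rotate:
  "(\<Sum>i\<in>I. \<Sum>j\<in>J. \<Sum>k\<in>K. f i j k) = (\<Sum>j\<in>J. \<Sum>k\<in>K. \<Sum>i\<in>I. f i j k)"
  by (simp add: sum.swap[of _ I])

lemma conj_by_nth:
  "conj_by W A $ a $ b = (\<Sum>c\<in>UNIV. \<Sum>d\<in>UNIV. W $ a $ c * A $ c $ d * cnj (W $ b $ d))"
  unfolding conj_by_def matrix_matrix_mult_def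
  by (subst sum.swap) (simp add: sum_distrib_right)

text \<open>Orthonormality of the columns, in the form in which it arises when the factor carrying
  \<open>W\<close> is traced out.\<close>

lemma unitary_columns:
  assumes "unitary W"
  shows "(\<Sum>s\<in>UNIV. W $ s $ u * cnj (W $ s $ v)) = (if u = v then 1 else 0)"
proof -
  have "(dagger W ** W) $ v $ u = (\<Sum>s\<in>UNIV. W $ s $ u * cnj (W $ s $ v))"
    by (simp add: matrix_matrix_mult_def mult.commute)
  moreover have "dagger W ** W = mat 1"
    using assms by (simp add: unitary_def)
  ultimately show ?thesis by (simp add: mat_def eq_commute)
qed

text \<open>Moving the sum over the traced index innermost isolates a product of two columns of
  \<open>Z\<close>. By orthonormality this is a Kronecker delta, which contracts the system indices
  of \<open>A\<close> to a partial trace.\<close>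

lemma ptrace_sys_conj_by_kron:
  fixes A :: "('f::finite \<times> 's::finite) cmat"
  assumes "unitary Z"
  shows "ptrace_sys (conj_by (kron Y Z) A) = conj_by Y (ptrace_sys A)"
proof -
  have "ptrace_sys (conj_by (kron Y Z) A) $ a $ b = conj_by Y (ptrace_sys A) $ a $ b" for a b
  proof -
    have "ptrace_sys (conj_by (kron Y Z) A) $ a $ b =
      (\<Sum>s\<in>UNIV. \<Sum>p\<in>UNIV. \<Sum>q\<in>UNIV. Y $ a $ fst p * A $ p $ q * cnj (Y $ b $ fst q)
        * (Z $ s $ snd p * cnj (Z $ s $ snd q)))"
      by (simp add: ptrace_sys_def conj_by_nth kron_def mult_ac)
    also have "\<dots> = (\<Sum>p\<in>UNIV. \<Sum>q\<in>UNIV. Y $ a $ fst p * A $ p $ q * cnj (Y $ b $ fst q)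
        * (\<Sum>s\<in>UNIV. Z $ s $ snd p * cnj (Z $ s $ snd q)))"
      unfolding sum_distrib_left by (rule sum_rotate)
    also have "\<dots> = (\<Sum>c\<in>UNIV. \<Sum>u\<in>UNIV. \<Sum>d\<in>UNIV. Y $ a $ c * A $ (c, u) $ (d, u) * cnj (Y $ b $ d))"
      by (simp add: unitary_columns[OF assms] sum.cartesian_product' case_prod_beta
          if_distrib[of "\<lambda>x. _ * x"] cong: if_cong flip: UNIV_Times_UNIV)
    also have "\<dots> = (\<Sum>c\<in>UNIV. \<Sum>d\<in>UNIV. \<Sum>u\<in>UNIV. Y $ a $ c * A $ (c, u) $ (d, u) * cnj (Y $ b $ d))"
      by (subst (2) sum.swap) simp
    also have "\<dots> = conj_by Y (ptrace_sys A) $ a $ b"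
      by (simp add: conj_by_nth ptrace_sys_def sum_distrib_left sum_distrib_right)
    finally show ?thesis .
  qed
  then show ?thesis by (simp add: vec_eq_iff)
qed

lemma ptrace_frame_conj_by_kron:
  fixes A :: "('f::finite \<times> 's::finite) cmat"
  assumes "unitary Y"
  shows "ptrace_frame (conj_by (kron Y Z) A) = conj_by Z (ptrace_frame A)"
proof -
  \<comment> \<open>The delta now compares frame indices, while the innermost sum runs over a system
    index. The condition has to be pulled out of that sum before the delta can collapse the frame
    sum.\<close>
  have sum_if: "(\<Sum>i\<in>I. if Q then g i else 0) = (if Q then sum g I else 0)"
    for Q I and g :: "'s \<Rightarrow> complex"
    by simp
  have "ptrace_frame (conj_by (kron Y Z) A) $ a $ b = conj_by Z (ptrace_frame A) $ a $ b" for a b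
  proof -
    have "ptrace_frame (conj_by (kron Y Z) A) $ a $ b =
      (\<Sum>s\<in>UNIV. \<Sum>p\<in>UNIV. \<Sum>q\<in>UNIV. Z $ a $ snd p * A $ p $ q * cnj (Z $ b $ snd q)
        * (Y $ s $ fst p * cnj (Y $ s $ fst q)))"
      by (simp add: ptrace_frame_def conj_by_nth kron_def mult_ac)
    also have "\<dots> = (\<Sum>p\<in>UNIV. \<Sum>q\<in>UNIV. Z $ a $ snd p * A $ p $ q * cnj (Z $ b $ snd q)
        * (\<Sum>s\<in>UNIV. Y $ s $ fst p * cnj (Y $ s $ fst q)))"
      unfolding sum_distrib_left by (rule sum_rotate)
    also have "\<dots> = (\<Sum>u\<in>UNIV. \<Sum>c\<in>UNIV. \<Sum>d\<in>UNIV. Z $ a $ c * A $ (u, c) $ (u, d) * cnj (Z $ b $ d))"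
      by (simp add: unitary_columns[OF assms] sum.cartesian_product' case_prod_beta
          if_distrib[of "\<lambda>x. _ * x"] sum_if cong: if_cong flip: UNIV_Times_UNIV)
    also have "\<dots> = (\<Sum>c\<in>UNIV. \<Sum>d\<in>UNIV. \<Sum>u\<in>UNIV. Z $ a $ c * A $ (u, c) $ (u, d) * cnj (Z $ b $ d))"
      by (rule sum_rotate)
    also have "\<dots> = conj_by Z (ptrace_frame A) $ a $ b"
      by (simp add: conj_by_nth ptrace_frame_def sum_distrib_left sum_distrib_right)
    finally show ?thesis .
  qed
  then show ?thesis by (simp add: vec_eq_iff)
qed

section \<open>Orthogonal projections\<close>

text \<open>The link to the real inner product, through which real orthogonal decompositions become
  available.\<close>

lemma Re_cinner: "Re (cinner v w) = v \<bullet> w"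
  by (simp add: cinner_def inner_vec_def inner_complex_def)

text \<open>Replacing \<open>v\<close> by \<open>\<i> *s v\<close> multiplies
  \<open>cinner v w\<close> by \<open>- \<i>\<close>, so its imaginary part is again a real inner
  product.\<close>

lemma cinner_eq_0I:
  assumes "v \<bullet> w = 0" "(\<i> *s v) \<bullet> w = 0"
  shows "cinner v w = 0"
proof (rule complex_eqI)
  have "cinner (\<i> *s v) w = - \<i> * cinner v w"
    by (simp add: cinner_def sum_distrib_left mult_ac)
  then show "Im (cinner v w) = Im 0"
    using assms(2) by (simp flip: Re_cinner)
qed (use assms(1) in \<open>simp add: Re_cinner\<close>)

lemma cinner_right_simps:
  "cinner v (w + w') = cinner v w + cinner v w'"
  "cinner v (w - w') = cinner v w - cinner v w'"
  "cinner v (c *s w) = c * cinner v w"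
  by (simp_all add: cinner_def algebra_simps sum.distrib sum_subtractf sum_distrib_left)

lemma cinner_commute: "cinner w v = cnj (cinner v w)"
  by (simp add: cinner_def mult.commute)

lemma cinner_self_eq_0: "cinner v v = 0 \<Longrightarrow> v = 0"
  by (metis Re_cinner inner_eq_zero_iff zero_complex.simps(1))

text \<open>Testing on standard basis vectors reads off the matrix entries.\<close>

lemma hermitianI:
  assumes "\<And>v w. cinner (P *v v) w = cinner v (P *v w)"
  shows "hermitian P"
proof -
  have "cnj (P $ j $ i) = P $ i $ j" for i j
  proof -
    have "cinner (axis i 1) v = v $ i" "cinner v (axis i 1) = cnj (v $ i)" for i and v :: "complex^'a"
      by (simp_all add: cinner_def axis_def if_distrib[of cnj] if_distrib[of "\<lambda>x. x * _"]
          if_distrib[of "\<lambda>x. _ * x"] cong: if_cong)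
    moreover have "(P *v axis i 1) $ j = P $ j $ i" for i j
      by (simp add: matrix_vector_mult_def axis_def if_distrib[of "\<lambda>x. _ * x"] cong: if_cong)
    ultimately show ?thesis
      using assms[of "axis i 1" "axis j 1"] by simp
  qed
  then show ?thesis by (simp add: hermitian_def vec_eq_iff)
qed

text \<open>A complex subspace is also a real one, so every vector has a real orthogonal
  decomposition along \<open>E\<close>. Since \<open>E\<close> is closed under multiplication by
  \<open>\<i>\<close>, the remainder is orthogonal to \<open>E\<close> in the complex sense too. The
  resulting foot point is unique, hence linear in the vector, and its matrix is the
  projection.\<close>

lemma orth_proj_exists:
  fixes E :: "(complex^'n) set"
  assumes E: "vec.subspace E"
  obtains P where "hermitian P" "P ** P = P" "range ((*v) P) = E"
proof -
  have E_scale: "c *s v \<in> E" if "v \<in> E" for c v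
    using E that by (rule vec.subspace_scale)
  have E_diff: "v - w \<in> E" if "v \<in> E" "w \<in> E" for v w
    using E that by (rule vec.subspace_diff)
  have E_add: "v + w \<in> E" if "v \<in> E" "w \<in> E" for v w
    using E that by (rule vec.subspace_add)
  have "subspace E"
    unfolding subspace_def
  proof (intro conjI allI ballI)
    show "0 \<in> E" using E by (rule vec.subspace_0)
    show "c *\<^sub>R v \<in> E" if "v \<in> E" for c v
    proof -
      have "c *\<^sub>R v = complex_of_real c *s v" by (simp add: vec_eq_iff scaleR_conv_of_real[where 'a = complex])
      then show ?thesis using E_scale[OF that] by simp
    qed
  qed (rule E_add)
  then have span: "span E = E" by (simp add: span_eq_iff)
  have "\<exists>y. y \<in> E \<and> (\<forall>w\<in>E. cinner w (v - y) = 0)" for v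
  proof -
    obtain y z where yz: "y \<in> E" "\<And>w. w \<in> E \<Longrightarrow> orthogonal z w" "v = y + z"
      using orthogonal_subspace_decomp_exists[of E v] unfolding span by blast
    have "w \<bullet> z = 0" if "w \<in> E" for w
      using yz(2)[OF that] by (simp add: orthogonal_def inner_commute)
    then have "\<forall>w\<in>E. cinner w (v - y) = 0"
      using yz(3) E_scale by (auto intro!: cinner_eq_0I)
    then show ?thesis using yz(1) by blast
  qed
  then obtain f where f: "\<And>v. f v \<in> E" "\<And>v w. w \<in> E \<Longrightarrow> cinner w (v - f v) = 0"
    by metis
  \<comment> \<open>Two foot points of \<open>v\<close> differ by a vector of \<open>E\<close> that
    is orthogonal to itself. This uniqueness yields linearity of \<open>f\<close> and
    \<open>f v = v\<close> on \<open>E\<close>.\<close>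
  have f_eqI: "f v = y" if "y \<in> E" "\<And>w. w \<in> E \<Longrightarrow> cinner w (v - y) = 0" for v y
  proof -
    let ?d = "f v - y"
    have d: "?d \<in> E" using E_diff f(1) that(1) by blast
    have "cinner ?d ((v - y) - (v - f v)) = cinner ?d (v - y) - cinner ?d (v - f v)"
      by (rule cinner_right_simps(2))
    then have "cinner ?d ?d = 0" using that(2)[OF d] f(2)[OF d] by simp
    then show ?thesis using cinner_self_eq_0[of ?d] by simp
  qed
  have "Vector_Spaces.linear (*s) (*s) f"
  proof (unfold_locales)
    fix v w :: "complex^'n" and c
    have "v + w - (f v + f w) = (v - f v) + (w - f w)" by simp
    then have "cinner u (v + w - (f v + f w)) = 0" if "u \<in> E" for u
      using f(2)[OF that, of v] f(2)[OF that, of w] by (metis cinner_right_simps(1) add_0)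
    then show "f (v + w) = f v + f w"
      by (intro f_eqI E_add f(1))
    have "c *s v - c *s f v = c *s (v - f v)" by (simp add: vec_eq_iff algebra_simps)
    then show "f (c *s v) = c *s f v"
      using f by (intro f_eqI E_scale) (simp_all only: cinner_right_simps(3) mult_zero_right)
  qed
  then have Pf: "matrix f *v v = f v" for v
    by (rule matrix_works)
  have fix_E: "f v = v" if "v \<in> E" for v
    using that by (intro f_eqI) (simp_all add: cinner_def)
  show thesis
  proof
    \<comment> \<open>Since \<open>w - f w\<close> is orthogonal to \<open>f v\<close>, the second
      argument may be projected too. The resulting expression is symmetric up to conjugation, so
      \<open>f\<close> is self-adjoint.\<close>
    have eq: "cinner (f v) w = cinner (f v) (f w)" for v w
      using f(2)[OF f(1)[of v], of w] by (simp add: cinner_right_simps(2))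
    have "cinner (f v) w = cinner v (f w)" for v w
      unfolding eq[of v w] cinner_commute[of v "f w"] eq[of w v] by (rule cinner_commute)
    then show "hermitian (matrix f)"
      by (intro hermitianI) (simp add: Pf)
    show "matrix f ** matrix f = matrix f"
      by (simp add: matrix_eq Pf fix_E f(1) flip: matrix_vector_mul_assoc)
    show "range ((*v) (matrix f)) = E"
    proof -
      have "(*v) (matrix f) = f" by (simp add: fun_eq_iff Pf)
      moreover have "v \<in> range f" if "v \<in> E" for v
        using rangeI[of f v] by (simp add: fix_E that)
      ultimately show ?thesis using f(1) by auto
    qed
  qed
qed

lemma idempotent_fixes_range:
  "P ** P = P \<Longrightarrow> v \<in> range ((*v) P) \<Longrightarrow> P *v v = v"
  by (auto simp: matrix_vector_mul_assoc)

text \<open>Each projection fixes the common range, so \<open>P ** Q = Q\<close> and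
  \<open>Q ** P = P\<close>. The adjoint of the second equation reads
  \<open>P ** Q = P\<close>.\<close>

lemma orth_proj_unique:
  assumes "hermitian P" "P ** P = P" "hermitian Q" "Q ** Q = Q"
    and "range ((*v) P) = range ((*v) Q)"
  shows "P = Q"
proof -
  have PQ: "P ** Q = Q"
    unfolding matrix_eq matrix_vector_mul_assoc[symmetric]
    using idempotent_fixes_range[OF assms(2)] assms(5) by blast
  have "Q ** P = P"
    unfolding matrix_eq matrix_vector_mul_assoc[symmetric]
    using idempotent_fixes_range[OF assms(4)] assms(5) by blast
  then have "dagger P = dagger (Q ** P)" by simp
  also have "\<dots> = Q"
    using assms(1,3) PQ by (simp add: dagger_mult hermitian_def)
  finally show ?thesis using assms(1) by (simp add: hermitian_def)
qed

lemma orth_proj_eqI: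
  assumes "hermitian P" "P ** P = P" "range ((*v) P) = E"
  shows "orth_proj E = P"
  unfolding orth_proj_def
proof (rule the_equality)
  show "Q = P" if Q: "hermitian Q \<and> Q ** Q = Q \<and> range ((*v) Q) = E" for Q
  proof (rule orth_proj_unique)
    show "range ((*v) Q) = range ((*v) P)" using Q assms(3) by metis
  qed (use Q assms in blast)+
qed (use assms in blast)

lemma subspace_eigenspace: "vec.subspace (eigenspace A r)"
proof (rule vec.subspaceI)
  show "c *s v \<in> eigenspace A r" if "v \<in> eigenspace A r" for c v
    using that unfolding eigenspace_def mem_Collect_eq vector_scalar_commute
    by (metis vec.scale_left_commute)
qed (simp_all add: eigenspace_def matrix_vector_right_distrib vec.scale_right_distrib)

text \<open>Existence and uniqueness together justify the definite description in
  \<open>orth_proj\<close> for eigenspaces.\<close>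

lemma orth_proj_eigenspace:
  shows hermitian_orth_proj_eigenspace: "hermitian (orth_proj (eigenspace A r))" (is ?h)
    and idem_orth_proj_eigenspace:
      "orth_proj (eigenspace A r) ** orth_proj (eigenspace A r) = orth_proj (eigenspace A r)" (is ?i)
    and range_orth_proj_eigenspace:
      "range ((*v) (orth_proj (eigenspace A r))) = eigenspace A r" (is ?r)
proof -
  obtain P where "hermitian P" "P ** P = P" "range ((*v) P) = eigenspace A r"
    using orth_proj_exists[OF subspace_eigenspace] .
  moreover from this have "orth_proj (eigenspace A r) = P"
    by (rule orth_proj_eqI)
  ultimately show ?h ?i ?r by simp_all
qed

lemma orth_proj_eigenspace_eqI:
  assumes "hermitian P" "P ** P = P"
    and "\<And>v. A *v (P *v v) = of_real r *s (P *v v)"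
    and "\<And>v. A *v v = of_real r *s v \<Longrightarrow> P *v v = v"
  shows "orth_proj (eigenspace A r) = P"
proof (rule orth_proj_eqI)
  show "range ((*v) P) = eigenspace A r"
  proof (intro subset_antisym subsetI)
    fix v assume "v \<in> eigenspace A r"
    then have "v = P *v v" using assms(4) by (simp add: eigenspace_def)
    then show "v \<in> range ((*v) P)" by blast
  qed (auto simp: eigenspace_def assms(3))
qed (fact assms)+

lemma eigen_orth_proj:
  "A *v (orth_proj (eigenspace A r) *v v) = of_real r *s (orth_proj (eigenspace A r) *v v)"
proof -
  have "orth_proj (eigenspace A r) *v v \<in> eigenspace A r"
    using range_orth_proj_eigenspace by blast
  then show ?thesis unfolding eigenspace_def by simp
qed

lemma orth_proj_eigenvector:
  assumes "A *v v = of_real r *s v"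
  shows "orth_proj (eigenspace A r) *v v = v"
proof (rule idempotent_fixes_range[OF idem_orth_proj_eigenspace])
  show "v \<in> range ((*v) (orth_proj (eigenspace A r)))"
    unfolding range_orth_proj_eigenspace using assms by (simp add: eigenspace_def)
qed

lemma mult_orth_proj_eigenspace:
  "A ** orth_proj (eigenspace A r) = mat (of_real r) ** orth_proj (eigenspace A r)"
  by (simp add: matrix_eq eigen_orth_proj scalar_matrix_vector flip: matrix_vector_mul_assoc)

section \<open>Covariance of the functional calculus and of the entropies\<close>

lemma unitary_cancel_vector:
  assumes "unitary W"
  shows "dagger W *v (W *v v) = v" "W *v (dagger W *v v) = v"
  using assms by (simp_all add: matrix_vector_mul_assoc unitary_def)

lemma conj_by_vector: "conj_by W A *v v = W *v (A *v (dagger W *v v))"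
  by (simp add: conj_by_def flip: matrix_vector_mul_assoc)

lemma eigen_conj_by_iff:
  assumes "unitary W"
  shows "conj_by W A *v v = c *s v \<longleftrightarrow> A *v (dagger W *v v) = c *s (dagger W *v v)"
  unfolding conj_by_vector
  by (metis assms unitary_cancel_vector vector_scalar_commute)

lemma spectrum_conj_by:
  assumes "unitary W"
  shows "spectrum (conj_by W A) = spectrum A"
proof -
  have "(\<exists>v. v \<noteq> 0 \<and> A *v (dagger W *v v) = c *s (dagger W *v v)) \<longleftrightarrow>
      (\<exists>v. v \<noteq> 0 \<and> A *v v = c *s v)" for c
    by (metis assms unitary_cancel_vector matrix_vector_mult_0_right)
  then show ?thesis by (simp add: spectrum_def eigen_conj_by_iff[OF assms])
qed

lemma orth_proj_eigenspace_conj_by: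
  assumes "unitary W"
  shows "orth_proj (eigenspace (conj_by W A) r) = conj_by W (orth_proj (eigenspace A r))"
proof (rule orth_proj_eigenspace_eqI)
  fix v
  show "conj_by W A *v (conj_by W (orth_proj (eigenspace A r)) *v v) =
      of_real r *s (conj_by W (orth_proj (eigenspace A r)) *v v)"
    by (simp add: conj_by_vector unitary_cancel_vector assms eigen_orth_proj
        vector_scalar_commute)
next
  fix v assume "conj_by W A *v v = of_real r *s v"
  then show "conj_by W (orth_proj (eigenspace A r)) *v v = v"
    unfolding eigen_conj_by_iff[OF assms]
    by (simp add: conj_by_vector orth_proj_eigenvector unitary_cancel_vector assms)
qed (simp_all add: hermitian_conj_by hermitian_orth_proj_eigenspace conj_by_matrix_mult assms
    idem_orth_proj_eigenspace)

text \<open>Conjugation by \<open>W\<close> keeps the eigenvalues and conjugates each spectral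
  projection, so the defining sum transforms term by term.\<close>

lemma matrix_fun_conj_by:
  assumes "unitary W"
  shows "matrix_fun f (conj_by W A) = conj_by W (matrix_fun f A)"
  by (simp add: matrix_fun_def spectrum_conj_by orth_proj_eigenspace_conj_by assms conj_by_sum
      conj_by_scalar_mult)

lemma matrix_log_conj_by:
  "unitary W \<Longrightarrow> matrix_log (conj_by W A) = conj_by W (matrix_log A)"
  by (simp add: matrix_log_def matrix_fun_conj_by)

lemma vn_entropy_conj_by: "unitary W \<Longrightarrow> vn_entropy (conj_by W \<rho>) = vn_entropy \<rho>"
  by (simp add: vn_entropy_def matrix_log_conj_by conj_by_matrix_mult trace_conj_by)

lemma range_conj_by:
  assumes "unitary W"
  shows "range ((*v) (conj_by W A)) = (*v) W ` range ((*v) A)"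
proof -
  have "range ((*v) (dagger W)) = UNIV"
    using unitary_cancel_vector(1)[OF assms] by (metis surjI)
  moreover have "range ((*v) (conj_by W A)) = (*v) W ` (*v) A ` range ((*v) (dagger W))"
    by (simp add: conj_by_vector image_image)
  ultimately show ?thesis by simp
qed

text \<open>Injectivity of \<open>W\<close> preserves the support inclusion that separates the
  finite from the infinite case. In the finite case the functional calculus and the trace are
  covariant.\<close>

lemma relative_entropy_conj_by:
  assumes "unitary W"
  shows "relative_entropy (conj_by W \<rho>) (conj_by W \<sigma>) = relative_entropy \<rho> \<sigma>"
proof -
  have "inj ((*v) W)"
    using unitary_cancel_vector(1)[OF assms] by (metis injI)
  then have "range ((*v) (conj_by W \<rho>)) \<subseteq> range ((*v) (conj_by W \<sigma>)) \<longleftrightarrow>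
      range ((*v) \<rho>) \<subseteq> range ((*v) \<sigma>)"
    by (simp add: range_conj_by assms inj_image_subset_iff)
  then show ?thesis
    by (simp add: relative_entropy_def matrix_log_conj_by conj_by_matrix_mult trace_conj_by assms
        flip: conj_by_diff)
qed

text \<open>Bilocality makes the product of the marginals transform under the same global unitary as
  the state, so invariance of the relative entropy applies.\<close>

lemma mutual_information_conj_by_kron:
  assumes "unitary Y" "unitary Z"
  shows "mutual_information (conj_by (kron Y Z) \<rho>) = mutual_information \<rho>"
  by (simp add: mutual_information_def ptrace_sys_conj_by_kron ptrace_frame_conj_by_kron assms
      relative_entropy_conj_by unitary_kron flip: conj_by_kron)

lemma product_form_conj_by_kron:
  assumes "unitary Y" "unitary Z" "product_form \<rho>"
  shows "product_form (conj_by (kron Y Z) \<rho>)"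
  unfolding product_form_def ptrace_sys_conj_by_kron[OF assms(2)]
    ptrace_frame_conj_by_kron[OF assms(1)] conj_by_kron[symmetric]
  by (rule arg_cong[OF assms(3)[unfolded product_form_def]])

section \<open>Entropies of the marginals of a pure state\<close>

text \<open>On the range of a spectral projection \<open>A\<close> acts as the scalar
  \<open>r\<close>, and the trace of the projection counts the multiplicity. Dropping
  \<open>r = 0\<close>, where \<open>r * ln r\<close> vanishes, allows comparison of matrices with
  kernels of different dimension.\<close>

lemma vn_entropy_eq:
  "vn_entropy A = - (\<Sum>r\<in>spectrum A - {0}. r * ln r * Re (trace (orth_proj (eigenspace A r))))"
proof -
  let ?P = "\<lambda>r. orth_proj (eigenspace A r)"
  have "trace (A ** (mat (of_real (ln r)) ** ?P r)) = of_real (r * ln r) * trace (?P r)" for r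
  proof -
    have "A ** (mat (of_real (ln r)) ** ?P r) = mat (of_real (ln r)) ** (A ** ?P r)"
      by (simp add: matrix_mul_assoc scalar_matrix_commute)
    then show ?thesis
      by (simp add: mult_orth_proj_eigenspace trace_scalar_mult)
  qed
  then have "trace (A ** matrix_log A) = (\<Sum>r\<in>spectrum A. of_real (r * ln r) * trace (?P r))"
    by (simp add: matrix_log_def matrix_fun_def matrix_mult_sum_right trace_sum)
  then have "vn_entropy A = - (\<Sum>r\<in>spectrum A. r * ln r * Re (trace (?P r)))"
    by (simp add: vn_entropy_def)
  also have "(\<Sum>r\<in>spectrum A. r * ln r * Re (trace (?P r))) =
      (\<Sum>r\<in>spectrum A - {0}. r * ln r * Re (trace (?P r)))"
    \<comment> \<open>In the infinite case both sums are 0 by convention, since removing one point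
      leaves the set infinite.\<close>
    by (cases "finite (spectrum A)") (auto intro: sum.mono_neutral_right)
  finally show ?thesis .
qed

section \<open>Nonzero eigenvalues of \<open>M ** N\<close> and \<open>N ** M\<close>\<close>

lemma eigen_swap:
  fixes M :: "complex^'m^'n"
  assumes "(M ** N) *v v = c *s v"
  shows "(N ** M) *v (N *v v) = c *s (N *v v)"
proof -
  have "(N ** M) *v (N *v v) = N *v ((M ** N) *v v)"
    by (simp add: matrix_vector_mul_assoc matrix_mul_assoc)
  then show ?thesis by (simp add: assms vector_scalar_commute)
qed

lemma spectrum_swap_subset:
  fixes M :: "complex^'m^'n"
  shows "spectrum (M ** N) - {0} \<subseteq> spectrum (N ** M) - {0}"
proof
  fix r assume "r \<in> spectrum (M ** N) - {0}"
  then obtain v where r: "r \<noteq> 0" and v: "v \<noteq> 0" "(M ** N) *v v = of_real r *s v"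
    by (auto simp: spectrum_def)
  \<comment> \<open>Applying \<open>M\<close> to \<open>N *v v\<close> gives \<open>r\<close> times
    \<open>v\<close>, which is nonzero; so \<open>N\<close> sends the eigenvector to an
    eigenvector.\<close>
  have "N *v v \<noteq> 0"
  proof
    assume "N *v v = 0"
    then have "of_real r *s v = 0" using v(2) by (simp flip: matrix_vector_mul_assoc)
    then show False using r v(1) by (simp add: vec.scale_eq_0_iff)
  qed
  with eigen_swap[OF v(2)] r show "r \<in> spectrum (N ** M) - {0}"
    by (auto simp: spectrum_def)
qed

text \<open>If \<open>Q\<close> projects onto the \<open>r\<close>-eigenspace of \<open>M\<dagger> M\<close>, then \<open>r\<^sup>-\<^sup>1 M Q M\<dagger>\<close> projects onto that of
  \<open>M M\<dagger>\<close>.\<close>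

lemma trace_orth_proj_swap:
  fixes M :: "complex^'m^'n"
  assumes "r \<noteq> 0"
  shows "trace (orth_proj (eigenspace (M ** dagger M) r)) =
    trace (orth_proj (eigenspace (dagger M ** M) r))"
proof -
  define Q where "Q = orth_proj (eigenspace (dagger M ** M) r)"
  define c :: complex where "c = of_real (inverse r)"
  have c: "c * of_real r = 1" using assms by (simp add: c_def)
  have Q: "hermitian Q" "Q ** Q = Q" "dagger M ** M ** Q = mat (of_real r) ** Q"
    by (simp_all add: Q_def hermitian_orth_proj_eigenspace idem_orth_proj_eigenspace
        mult_orth_proj_eigenspace)
  \<comment> \<open>The factor \<open>c\<close> is the inverse of \<open>r\<close>: in
    \<open>P ** P\<close> the inner \<open>dagger M ** M\<close> acts on the range of
    \<open>Q\<close> as \<open>r\<close>, and \<open>c\<close> compensates this.\<close>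
  define P where "P = mat c ** (M ** Q ** dagger M)"
  have P_vec: "P *v v = c *s (M *v (Q *v (dagger M *v v)))" for v
    by (simp add: P_def scalar_matrix_vector flip: matrix_vector_mul_assoc)
  have MMQ: "dagger M *v (M *v (Q *v v)) = of_real r *s (Q *v v)" for v
    using arg_cong[OF Q(3), of "\<lambda>A. A *v v"]
    by (simp add: scalar_matrix_vector flip: matrix_vector_mul_assoc)
  have QQ: "Q *v (Q *v v) = Q *v v" for v
    using Q(2) by (simp add: matrix_vector_mul_assoc)
  have "orth_proj (eigenspace (M ** dagger M) r) = P"
  proof (rule orth_proj_eigenspace_eqI)
    show "hermitian P"
      using Q(1) unfolding hermitian_def P_def dagger_scalar_mult
      by (simp add: dagger_mult matrix_mul_assoc c_def)
    show "P ** P = P"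
      unfolding matrix_eq using c
      by (simp add: P_vec vector_scalar_commute MMQ QQ vector_smult_assoc mult.assoc
          flip: matrix_vector_mul_assoc)
    show "(M ** dagger M) *v (P *v v) = of_real r *s (P *v v)" for v
      by (simp add: P_vec vector_scalar_commute MMQ vector_smult_assoc mult.commute
          flip: matrix_vector_mul_assoc)
    fix v assume v: "(M ** dagger M) *v v = of_real r *s v"
    have "Q *v (dagger M *v v) = dagger M *v v"
      unfolding Q_def by (rule orth_proj_eigenvector[OF eigen_swap[OF v]])
    then have "P *v v = c *s ((M ** dagger M) *v v)"
      by (simp add: P_vec flip: matrix_vector_mul_assoc)
    then show "P *v v = v" using c by (simp add: v vector_smult_assoc)
  qed
  moreover have "trace P = trace Q"
  proof -
    have "trace P = c * trace (M ** Q ** dagger M)"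
      by (simp add: P_def trace_scalar_mult)
    also have "trace (M ** Q ** dagger M) = trace (dagger M ** (M ** Q))"
      by (rule trace_mul_sym)
    also have "\<dots> = of_real r * trace Q"
      by (simp add: matrix_mul_assoc Q(3) trace_scalar_mult)
    finally show ?thesis using c by (simp flip: mult.assoc)
  qed
  ultimately show ?thesis by (simp add: Q_def)
qed

text \<open>The nonzero eigenvalues agree, and so do their multiplicities, given as traces of the
  spectral projections.\<close>

lemma vn_entropy_swap: "vn_entropy (M ** dagger M) = vn_entropy (dagger M ** M)"
proof -
  have "spectrum (M ** dagger M) - {0} = spectrum (dagger M ** M) - {0}"
    by (intro subset_antisym spectrum_swap_subset)
  then show ?thesis
    by (simp add: vn_entropy_eq trace_orth_proj_swap)
qed

section \<open>Entropy of the complex conjugate matrix\<close>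

abbreviation cnj_vec :: "complex^'n \<Rightarrow> complex^'n"
  where "cnj_vec v \<equiv> (\<chi> i. cnj (v $ i))"

lemma cnj_matrix_vector: "map_matrix cnj A *v v = cnj_vec (A *v cnj_vec v)"
  by (simp add: vec_eq_iff matrix_vector_mult_def map_matrix_def)

lemma cnj_vec_scale: "cnj_vec (c *s v) = cnj c *s cnj_vec v"
  by (simp add: vec_eq_iff)

lemma cnj_vec_cnj_vec: "cnj_vec (cnj_vec v) = v"
  by (simp add: vec_eq_iff)

lemma cnj_matrix_mult: "map_matrix cnj (A ** B) = map_matrix cnj A ** map_matrix cnj B"
  by (simp add: vec_eq_iff matrix_matrix_mult_def map_matrix_def)

text \<open>Conjugating the eigenvalue equation entrywise leaves the real eigenvalue fixed.\<close>

lemma eigen_cnj_iff: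
  "map_matrix cnj A *v v = of_real r *s v \<longleftrightarrow> A *v cnj_vec v = of_real r *s cnj_vec v"
  by (metis cnj_matrix_vector cnj_vec_cnj_vec cnj_vec_scale complex_cnj_complex_of_real)

lemma spectrum_cnj: "spectrum (map_matrix cnj A) = spectrum A"
proof -
  have "cnj_vec v \<noteq> 0 \<longleftrightarrow> v \<noteq> 0" for v :: "complex^'a"
    by (simp add: vec_eq_iff)
  then have "(\<exists>v. v \<noteq> 0 \<and> A *v cnj_vec v = of_real r *s cnj_vec v) \<longleftrightarrow>
      (\<exists>v. v \<noteq> 0 \<and> A *v v = of_real r *s v)" for r
    by (metis cnj_vec_cnj_vec)
  then show ?thesis by (simp add: spectrum_def eigen_cnj_iff)
qed

lemma orth_proj_eigenspace_cnj:
  "orth_proj (eigenspace (map_matrix cnj A) r) = map_matrix cnj (orth_proj (eigenspace A r))"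
proof (rule orth_proj_eigenspace_eqI)
  show "hermitian (map_matrix cnj (orth_proj (eigenspace A r)))"
    using hermitian_orth_proj_eigenspace[of A r]
    by (simp add: hermitian_def vec_eq_iff map_matrix_def)
  fix v
  show "map_matrix cnj A *v (map_matrix cnj (orth_proj (eigenspace A r)) *v v) =
      of_real r *s (map_matrix cnj (orth_proj (eigenspace A r)) *v v)"
    unfolding eigen_cnj_iff by (simp add: cnj_matrix_vector cnj_vec_cnj_vec eigen_orth_proj)
next
  fix v assume "map_matrix cnj A *v v = of_real r *s v"
  then have "orth_proj (eigenspace A r) *v cnj_vec v = cnj_vec v"
    unfolding eigen_cnj_iff by (rule orth_proj_eigenvector)
  then show "map_matrix cnj (orth_proj (eigenspace A r)) *v v = v"
    by (simp add: cnj_matrix_vector cnj_vec_cnj_vec)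
qed (simp add: idem_orth_proj_eigenspace flip: cnj_matrix_mult)

lemma vn_entropy_cnj: "vn_entropy (map_matrix cnj A) = vn_entropy A"
proof -
  have "Re (trace (map_matrix cnj B)) = Re (trace B)" for B :: "'a cmat"
    by (simp add: trace_def map_matrix_def)
  then show ?thesis
    by (simp add: vn_entropy_eq spectrum_cnj orth_proj_eigenspace_cnj)
qed

text \<open>Reshaping the vector into its coefficient matrix replaces a Schmidt decomposition: the
  marginals become the two Gram matrices of \<open>M\<close>, one of them up to complex
  conjugation.\<close>

lemma vn_entropy_marginals_outer:
  "vn_entropy (ptrace_sys (outer \<psi> \<psi>)) = vn_entropy (ptrace_frame (outer \<psi> \<psi>))"
proof -
  define M where "M = (\<chi> a s. \<psi> $ (a, s))"
  have "ptrace_sys (outer \<psi> \<psi>) = M ** dagger M"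
    by (simp add: vec_eq_iff ptrace_sys_def outer_def M_def matrix_matrix_mult_def)
  moreover have "ptrace_frame (outer \<psi> \<psi>) = map_matrix cnj (dagger M ** M)"
    by (simp add: vec_eq_iff ptrace_frame_def outer_def M_def matrix_matrix_mult_def map_matrix_def)
  ultimately show ?thesis
    by (simp add: vn_entropy_cnj vn_entropy_swap)
qed

lemma conj_by_outer: "conj_by W (outer \<psi> \<psi>) = outer (W *v \<psi>) (W *v \<psi>)"
  by (simp add: vec_eq_iff conj_by_nth outer_def matrix_vector_mult_def sum_product mult_ac)

section \<open>Comparison of the two perspectives\<close>

lemma parity_swap_eq_frame_change: "parity_swap gi gj U = frame_change gi gj U"
  by (simp add: parity_swap_def frame_change_def add.commute)

theorem lemma14:
  fixes gi gj :: "'g::{finite,ab_group_add}"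
    and U :: "'g \<Rightarrow> 's::finite cmat"
    and H :: "('g \<times> 's) cmat"
    and \<rho>bar_i \<rho>bar_j :: "real \<Rightarrow> ('g \<times> 's) cmat"
    and \<rho>_j \<rho>_i :: "real \<Rightarrow> 'g cmat"
    and \<rho>_SRi \<rho>_SRj :: "real \<Rightarrow> 's cmat"
    and Y0 Y1 :: "'g cmat"
    and Z0 Z1 :: "'s cmat"
    and t0 t1 :: real
  assumes "(UNIV :: 'g set) \<noteq> {0}"
    and "unitary_rep U"
    and "hermitian H"
    and "\<forall>t. density_op (\<rho>bar_i t)"
    and "evolves_under H \<rho>bar_i"
    and "\<forall>t. \<rho>bar_j t = conj_by (frame_change gi gj U) (\<rho>bar_i t)"
    and "\<forall>t. \<rho>_j t = ptrace_sys (\<rho>bar_i t)"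
    and "\<forall>t. \<rho>_SRi t = ptrace_frame (\<rho>bar_i t)"
    and "\<forall>t. \<rho>_i t = ptrace_sys (\<rho>bar_j t)"
    and "\<forall>t. \<rho>_SRj t = ptrace_frame (\<rho>bar_j t)"
    and "t0 < t1"
    and "unitary Y0" "unitary Z0" "unitary Y1" "unitary Z1"
    and "\<rho>bar_i t0 \<in> tps_invariant gi gj U (kron Y0 Z0)"
    and "\<rho>bar_i t1 \<in> tps_invariant gi gj U (kron Y1 Z1)"
  shows "(entropy_change \<rho>_i t0 t1 = entropy_change \<rho>_j t0 t1 \<and>
          entropy_change \<rho>_SRj t0 t1 = entropy_change \<rho>_SRi t0 t1 \<and>
          (pure_state (\<rho>bar_i t0) \<longrightarrow>
             entropy_change \<rho>_j t0 t1 = entropy_change \<rho>_SRi t0 t1 \<and>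
             entropy_change \<rho>_i t0 t1 = entropy_change \<rho>_SRj t0 t1)) \<and>
         ((product_form (\<rho>bar_i t0) \<and> product_form (\<rho>bar_j t0) \<and>
           entropy_production \<rho>bar_j t0 t1 = entropy_production \<rho>bar_i t0 t1 \<and>
           entropy_flow \<rho>bar_j t0 t1 = entropy_flow \<rho>bar_i t0 t1)
          \<longleftrightarrow>
          (product_form (\<rho>bar_i t0) \<and>
           relative_entropy (conj_by (Y0 ** dagger Y1) (\<rho>_j t1)) (\<rho>_j t0)
             = relative_entropy (\<rho>_j t1) (\<rho>_j t0)))"
proof -
  have un: "unitary (dagger Y0)" "unitary (dagger Z0)" "unitary (dagger Y1)" "unitary (dagger Z1)"
    using assms(12-15) by (simp_all add: unitary_dagger)
  \<comment> \<open>At the two invariance times the frame change, which equals the parity swap, may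
    be replaced by the adjoint of the bilocal unitary.\<close>
  have j0: "\<rho>bar_j t0 = conj_by (kron (dagger Y0) (dagger Z0)) (\<rho>bar_i t0)"
    and j1: "\<rho>bar_j t1 = conj_by (kron (dagger Y1) (dagger Z1)) (\<rho>bar_i t1)"
    using assms(6,16,17) by (simp_all add: tps_invariant_def parity_swap_eq_frame_change dagger_kron)
  have i: "\<rho>_i t0 = conj_by (dagger Y0) (\<rho>_j t0)" "\<rho>_i t1 = conj_by (dagger Y1) (\<rho>_j t1)"
    and S: "\<rho>_SRj t0 = conj_by (dagger Z0) (\<rho>_SRi t0)" "\<rho>_SRj t1 = conj_by (dagger Z1) (\<rho>_SRi t1)"
    using assms(7-10) un by (simp_all add: j0 j1 ptrace_sys_conj_by_kron ptrace_frame_conj_by_kron)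
  have dS: "entropy_change \<rho>_i t0 t1 = entropy_change \<rho>_j t0 t1"
      "entropy_change \<rho>_SRj t0 t1 = entropy_change \<rho>_SRi t0 t1"
    by (simp_all add: entropy_change_def i S vn_entropy_conj_by un)
  have pure: "entropy_change \<rho>_j t0 t1 = entropy_change \<rho>_SRi t0 t1" if "pure_state (\<rho>bar_i t0)"
  proof -
    obtain \<psi> where \<psi>: "\<rho>bar_i t0 = outer \<psi> \<psi>"
      using \<open>pure_state _\<close> by (auto simp: pure_state_def)
    \<comment> \<open>The propagator maps \<open>outer \<psi> \<psi>\<close> to another matrix of
      this form, so the marginal entropies agree at both times.\<close>
    have "\<rho>bar_i t1 = conj_by (propagator H (t1 - t0)) (\<rho>bar_i t0)"
      using assms(5) unfolding evolves_under_def by blast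
    with \<psi> show ?thesis
      using assms(7,8) by (simp add: entropy_change_def conj_by_outer vn_entropy_marginals_outer)
  qed
  \<comment> \<open>Conjugating both arguments by \<open>Y0\<close> returns
    \<open>\<rho>_i t0\<close> to \<open>\<rho>_j t0\<close> and leaves
    \<open>Y0 ** dagger Y1\<close> acting on \<open>\<rho>_j t1\<close>.\<close>
  have rel_i: "relative_entropy (\<rho>_i t1) (\<rho>_i t0) =
      relative_entropy (conj_by (Y0 ** dagger Y1) (\<rho>_j t1)) (\<rho>_j t0)"
    using relative_entropy_conj_by[OF assms(12), of "\<rho>_i t1" "\<rho>_i t0"]
    by (simp add: i conj_by_mult assms(12))
  have mutual: "mutual_information (\<rho>bar_j t1) = mutual_information (\<rho>bar_i t1)"
    by (simp add: j1 mutual_information_conj_by_kron un)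
  have prod: "product_form (\<rho>bar_i t0) \<Longrightarrow> product_form (\<rho>bar_j t0)"
    by (simp add: j0 product_form_conj_by_kron un)
  have marg: "(\<lambda>t. ptrace_sys (\<rho>bar_i t)) = \<rho>_j" "(\<lambda>t. ptrace_sys (\<rho>bar_j t)) = \<rho>_i"
    using assms(7,9) by auto
  \<comment> \<open>The common entropy change is a finite real, so it cancels even if a relative
    entropy is infinite.\<close>
  have flow: "entropy_flow \<rho>bar_j t0 t1 = entropy_flow \<rho>bar_i t0 t1 \<longleftrightarrow>
      relative_entropy (\<rho>_i t1) (\<rho>_i t0) = relative_entropy (\<rho>_j t1) (\<rho>_j t0)"
    unfolding entropy_flow_def marg dS using assms(7,9) by (simp add: ereal_add_cancel_left)
  \<comment> \<open>One direction suffices: in the final equivalence, equality of the relative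
    entropies is recovered from the flow, so the extended-real mutual information never has to be
    cancelled.\<close>
  have production: "entropy_production \<rho>bar_j t0 t1 = entropy_production \<rho>bar_i t0 t1"
    if "relative_entropy (\<rho>_i t1) (\<rho>_i t0) = relative_entropy (\<rho>_j t1) (\<rho>_j t0)"
    using that assms(7,9) by (simp add: entropy_production_def mutual)
  show ?thesis
    using dS pure prod flow production unfolding rel_i by metis
qed

end
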